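(* Consider the problem $\min\{f(x):=\frac12\|\mathcal{A}x-b\|^2 : x\in\mathcal{C}\}$ (the FISTA formulation of the ellipsoid separation problem). Assume that $\mathrm{Null}(\mathcal{A})\cap\mathcal{C}=\{0\}$ and that $v=(v_R,v_D)$ is the infimal displacement vector of PDHG applied to the ellipsoid separation problem. Then: (i) There exists $\bar x\in\mathcal{C}$ such that $b-\mathcal{A}\bar x=v_D$. (ii) $v_D$ is the unique minimal residual vector, i.e. $\mathcal{S}:=\{x\in\mathcal{C} : b-\mathcal{A}x=v_D\}$ is exactly the set of optimizers of $\min\{f(x):x\in\mathcal{C}\}$.
   Context: Norms are Euclidean (spectral for matrices). Ellipsoid separation problem (ESP): given nonsingular $d\times d$ real matrices $A_1,\dots,A_j,B_1,\dots,B_l$ and vectors $c_1,\dots,c_j,d_1,\dots,d_l\in\mathbb{R}^d$, let $C_i=\{z:\|A_i^{-1}(z-c_i)\|\le1\}$, $D_i=\{z:\|B_i^{-1}(z-d_i)\|\le 1\}$. Normalization is assumed: $\max\{\max_i\{\|c_i\|,\|A_i\|\},\max_i\{\|d_i\|,\|B_i\|\}\}=1$. Let $C_2^{d+1}=\{(\tau,p)\in\mathbb{R}\times\mathbb{R}^d:\|p\|\le\tau\}$ be the second-order cone and $\mathcal{C}=C_2^{d+1}\times\cdots\times C_2^{d+1}$ ($j+l$ times). Let $b=(1,1,0)\in\mathbb{R}\times\mathbb{R}\times\mathbb{R}^d$. The matrix $\mathcal{A}\in\mathbb{R}^{(d+2)\times(j+l)(d+1)}$ is the linear map sending $x=(\lambda_1,p_1,\dots,\lambda_j,p_j,\mu_1,q_1,\dots,\mu_l,q_l)$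 (with $\lambda_i,\mu_i\in\mathbb{R}$, $p_i,q_i\in\mathbb{R}^d$) to $$\mathcal{A}x=\Big(\sum_{i=1}^j\lambda_i,\ \sum_{i=1}^l\mu_i,\ \sum_{i=1}^j(\lambda_ic_i+A_ip_i)-\sum_{i=1}^l(\mu_id_i-B_iq_i)\Big).$$ PDHG (primal-dual hybrid gradient) for $\min\{0:\mathcal{A}x=b,\ x\in\mathcal{C}\}$ is the iteration $(x^+,y^+)=T(x,y)$ with $x^+=\mathrm{proj}_{\mathcal{C}}(x-\sigma\mathcal{A}^Ty)$, $y^+=y+\mathcal{A}(2x^+-x)-b$, where $0<\sigma<1/\|\mathcal{A}\|^2$ (and the other step size is $\tau=1$). The infimal displacement vector is $$v=(v_R,v_D)=\operatorname{argmin}\{\|v\|_M : v\in\mathrm{cl}(\mathrm{Range}(\mathrm{Id}-T))\},\qquad M=\begin{pmatrix}\frac1\sigma I&-\mathcal{A}^T\\-\mathcal{A}&I\end{pmatrix},$$ with $\|v\|_M=\sqrt{v^TMv}$; the set $\mathrm{cl}(\mathrm{Range}(\mathrm{Id}-T))$ is closed, convex and nonempty, so the minimizer is unique. *)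

theory Defs
  imports "HOL-Analysis.Analysis"
begin

definition spectral_norm :: "real ^ 'n ^ 'm \<Rightarrow> real" where
  "spectral_norm A = onorm (\<lambda>z. A *v z)"

definition second_order_cone :: "(real \<times> (real ^ 'n)) set" where
  "second_order_cone = {(t, p). norm p \<le> t}"

text \<open>
  The ellipsoids of the separation problem are \<open>{z. norm (matrix_inv (A i) *v (z - c i)) \<le> 1}\<close> and
  \<open>{z. norm (matrix_inv (B i) *v (z - d i)) \<le> 1}\<close>, indexed by the finite types \<open>'j\<close> and \<open>'l\<close>,
  in the space \<open>real ^ 'n\<close>.
\<close>

definition esp_instance ::
  "('j::finite \<Rightarrow> real ^ 'n ^ 'n) \<Rightarrow> ('j \<Rightarrow> real ^ 'n) \<Rightarrow>
   ('l::finite \<Rightarrow> real ^ 'n ^ 'n) \<Rightarrow> ('l \<Rightarrow> real ^ 'n) \<Rightarrow> bool" where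
  "esp_instance A c B d \<longleftrightarrow>
     (\<forall>i. invertible (A i)) \<and> (\<forall>i. invertible (B i)) \<and>
     max (Max (range (\<lambda>i. norm (c i)) \<union> range (\<lambda>i. spectral_norm (A i))))
         (Max (range (\<lambda>i. norm (d i)) \<union> range (\<lambda>i. spectral_norm (B i)))) = 1"

text \<open>
  The primal variable is a pair \<open>(u, w)\<close> whose blocks are \<open>u $ i = (\<lambda>\<^sub>i, p\<^sub>i)\<close> and
  \<open>w $ i = (\<mu>\<^sub>i, q\<^sub>i)\<close>. The library norm and inner product of this type are the Euclidean ones.
\<close>

type_synonym ('j, 'l, 'n) esp_primal =
  "((real \<times> (real ^ 'n)) ^ 'j) \<times> ((real \<times> (real ^ 'n)) ^ 'l)"

type_synonym 'n esp_dual = "real \<times> real \<times> (real ^ 'n)"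

definition esp_cone :: "('j::finite, 'l::finite, 'n::finite) esp_primal set" where
  "esp_cone = {(u, w). (\<forall>i. u $ i \<in> second_order_cone) \<and> (\<forall>i. w $ i \<in> second_order_cone)}"

definition esp_map ::
  "('j::finite \<Rightarrow> real ^ 'n ^ 'n) \<Rightarrow> ('j \<Rightarrow> real ^ 'n) \<Rightarrow>
   ('l::finite \<Rightarrow> real ^ 'n ^ 'n) \<Rightarrow> ('l \<Rightarrow> real ^ 'n) \<Rightarrow>
   ('j, 'l, 'n::finite) esp_primal \<Rightarrow> 'n esp_dual" where
  "esp_map A c B d = (\<lambda>(u, w).
     (\<Sum>i\<in>UNIV. fst (u $ i),
      \<Sum>i\<in>UNIV. fst (w $ i),
      (\<Sum>i\<in>UNIV. fst (u $ i) *\<^sub>R c i + A i *v snd (u $ i)) -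
      (\<Sum>i\<in>UNIV. fst (w $ i) *\<^sub>R d i - B i *v snd (w $ i))))"

definition esp_rhs :: "'n::finite esp_dual" where
  "esp_rhs = (1, 1, 0)"

text \<open>
  PDHG for \<open>min {0 : K x = b, x \<in> C}\<close> with primal step size \<open>\<sigma>\<close> and dual step size 1.
\<close>

definition pdhg_step ::
  "('a::euclidean_space \<Rightarrow> 'b::euclidean_space) \<Rightarrow> 'b \<Rightarrow> 'a set \<Rightarrow> real \<Rightarrow> 'a \<times> 'b \<Rightarrow> 'a \<times> 'b" where
  "pdhg_step K b C \<sigma> = (\<lambda>(x, y).
     let x' = closest_point C (x - \<sigma> *\<^sub>R adjoint K y)
     in (x', y + K (2 *\<^sub>R x' - x) - b))"

definition pdhg_matrix ::
  "('a::euclidean_space \<Rightarrow> 'b::euclidean_space) \<Rightarrow> real \<Rightarrow> 'a \<times> 'b \<Rightarrow> 'a \<times> 'b" where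
  "pdhg_matrix K \<sigma> = (\<lambda>(x, y). ((1 / \<sigma>) *\<^sub>R x - adjoint K y, - K x + y))"

definition pdhg_norm ::
  "('a::euclidean_space \<Rightarrow> 'b::euclidean_space) \<Rightarrow> real \<Rightarrow> 'a \<times> 'b \<Rightarrow> real" where
  "pdhg_norm K \<sigma> v = sqrt (v \<bullet> pdhg_matrix K \<sigma> v)"

definition is_infimal_displacement ::
  "('a::euclidean_space \<Rightarrow> 'b::euclidean_space) \<Rightarrow> 'b \<Rightarrow> 'a set \<Rightarrow> real \<Rightarrow> 'a \<times> 'b \<Rightarrow> bool" where
  "is_infimal_displacement K b C \<sigma> v \<longleftrightarrow>
     is_arg_min (pdhg_norm K \<sigma>) (\<lambda>w. w \<in> closure (range (\<lambda>z. z - pdhg_step K b C \<sigma> z))) v"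

definition least_squares ::
  "('a::euclidean_space \<Rightarrow> 'b::euclidean_space) \<Rightarrow> 'b \<Rightarrow> 'a \<Rightarrow> real" where
  "least_squares K b x = 1 / 2 * (norm (K x - b))\<^sup>2"

end

theory Submission
  imports Defs
begin

text \<open>
  Write \<open>K\<close> for the linear map and \<open>C\<close> for the cone. For \<open>z = (x, y)\<close> with primal update \<open>x'\<close>, the
  displacement \<open>(s, t) = z - T z\<close> has \<open>s = x - x'\<close> and \<open>t = b - K x' + K s\<close>. So \<open>t - K s\<close> is a
  residual \<open>b - K x'\<close> with \<open>x' \<in> C\<close>, and completing the square in the metric of PDHG gives
  \<open>\<parallel>(s, t)\<parallel>\<^sub>M\<^sup>2 = \<parallel>t - K s\<parallel>\<^sup>2 + (\<parallel>s\<parallel>\<^sup>2 / \<sigma> - \<parallel>K s\<parallel>\<^sup>2)\<close>,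
  where the step size condition makes the second term positive unless \<open>s = 0\<close>. Hence no displacement
  is shorter than the minimal residual \<open>r\<close>, and this survives the passage to the closure. The bound
  is attained at \<open>(0, r)\<close>: if \<open>x \<in> C\<close> has residual \<open>r\<close>, then starting at \<open>(x, 0)\<close> the projection
  leaves \<open>x\<close> fixed, so the displacement there is exactly \<open>(0, r)\<close>. Equality forces
  \<open>s = 0\<close> and makes \<open>t\<close> a residual of minimal norm; the residuals form a convex set, so
  \<open>t = r\<close>. Consequently the infimal displacement vector is \<open>(0, r)\<close>, and the points of \<open>C\<close> with
  residual \<open>r\<close> are the least-squares solutions.

  The minimal residual exists because the image of \<open>C\<close> under \<open>K\<close> is closed, which follows from the
  trivial intersection of \<open>C\<close> with the null space of \<open>K\<close>
  (\<open>coercive_on_closed_cone\<close>, \<open>closed_linear_image_of_cone\<close>). The result for an abstract convex set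
  is \<open>infimal_displacement_eq_minimal_residual\<close>.
\<close>

section \<open>Linear images of closed cones\<close>

text \<open>
  On the compact set of unit vectors of the cone, \<open>norm (K x)\<close> attains a minimum, which is positive
  because \<open>K\<close> does not vanish there; homogeneity extends the bound to the whole cone.
\<close>

lemma coercive_on_closed_cone:
  fixes K :: "'a::euclidean_space \<Rightarrow> 'b::real_normed_vector"
  assumes K: "linear K" and C: "closed C" "conic C" and ker: "{x. K x = 0} \<inter> C \<subseteq> {0}"
  obtains e where "0 < e" and "\<And>x. x \<in> C \<Longrightarrow> e * norm x \<le> norm (K x)"
proof (cases "C \<inter> sphere 0 1 = {}")
  case True
  have "x = 0" if "x \<in> C" for x
  proof (rule ccontr)
    assume "x \<noteq> 0"
    then have "(1 / norm x) *\<^sub>R x \<in> C \<inter> sphere 0 1"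
      using conicD[OF C(2) that, of "1 / norm x"] by simp
    with True show False by blast
  qed
  then show ?thesis by (intro that[of 1]) (fastforce intro: that)+
next
  case False
  have cont: "continuous_on (C \<inter> sphere 0 1) (\<lambda>x. norm (K x))"
    using K by (intro continuous_intros linear_continuous_on) (simp add: linear_linear)
  have "compact (C \<inter> sphere 0 1)"
    using C(1) by (simp add: closed_Int_compact)
  from continuous_attains_inf[OF this False cont]
  obtain u where u: "u \<in> C \<inter> sphere 0 1"
    and u_min: "\<And>x. x \<in> C \<inter> sphere 0 1 \<Longrightarrow> norm (K u) \<le> norm (K x)" by blast
  show ?thesis
  proof (rule that[of "norm (K u)"])
    show "0 < norm (K u)" using u ker by auto
    fix x assume x: "x \<in> C"
    show "norm (K u) * norm x \<le> norm (K x)"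
    proof (cases "x = 0")
      case False
      then have "(1 / norm x) *\<^sub>R x \<in> C \<inter> sphere 0 1"
        using conicD[OF C(2) x, of "1 / norm x"] by simp
      from u_min[OF this] show ?thesis
        using False by (simp add: linear_scale[OF K] field_simps)
    qed simp
  qed
qed

text \<open>
  Coercivity confines the preimages of points near a limit point to a bounded part of the cone, whose
  image is compact.
\<close>

lemma closed_linear_image_of_cone:
  fixes K :: "'a::euclidean_space \<Rightarrow> 'b::euclidean_space"
  assumes K: "linear K" and C: "closed C" "conic C" and ker: "{x. K x = 0} \<inter> C \<subseteq> {0}"
  shows "closed (K ` C)"
proof -
  obtain e where e: "0 < e" "\<And>x. x \<in> C \<Longrightarrow> e * norm x \<le> norm (K x)"
    using coercive_on_closed_cone[OF K C ker] by blast
  have "y \<in> K ` C" if y: "y \<in> closure (K ` C)" for y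
  proof -
    define R where "R = (norm y + 1) / e"
    have "ball y 1 \<inter> K ` C \<subseteq> K ` (C \<inter> cball 0 R)"
    proof
      fix z assume "z \<in> ball y 1 \<inter> K ` C"
      then obtain x where x: "x \<in> C" "z = K x" and "dist y z < 1" by auto
      then have "norm (K x) \<le> norm y + 1"
        using norm_triangle_sub[of z y] by (simp add: dist_norm norm_minus_commute)
      with e(2)[OF x(1)] have "norm x \<le> R"
        using e(1) by (simp add: R_def field_simps)
      with x show "z \<in> K ` (C \<inter> cball 0 R)" by auto
    qed
    moreover have "closed (K ` (C \<inter> cball 0 R))"
      using K C(1) by (intro compact_imp_closed compact_continuous_image linear_continuous_on)
        (simp_all add: linear_linear closed_Int_compact)
    ultimately have "closure (ball y 1 \<inter> K ` C) \<subseteq> K ` (C \<inter> cball 0 R)"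
      by (rule closure_minimal)
    moreover have "y \<in> closure (ball y 1 \<inter> K ` C)"
      using open_Int_closure_subset[of "ball y 1" "K ` C"] y by auto
    ultimately show ?thesis by blast
  qed
  then show ?thesis by (metis closure_subset closure_closed subsetI subset_antisym closure_eq)
qed

section \<open>The displacement of PDHG\<close>

lemma closed_residuals:
  fixes K :: "'a \<Rightarrow> 'b::real_normed_vector"
  assumes "closed (K ` C)"
  shows "closed ((\<lambda>x. b - K x) ` C)"
  using closed_translation[OF closed_negations[OF assms], of b] by (simp add: image_image)

lemma convex_residuals:
  fixes K :: "'a::real_vector \<Rightarrow> 'b::real_vector"
  assumes "linear K" "convex C"
  shows "convex ((\<lambda>x. b - K x) ` C)"
  using convex_translation[OF convex_negations[OF convex_linear_image[OF assms]], of b]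
  by (simp add: image_image)

lemma pdhg_matrix_complete_square:
  fixes K :: "'a::euclidean_space \<Rightarrow> 'b::euclidean_space"
  assumes K: "linear K"
  shows "(s, t) \<bullet> pdhg_matrix K \<sigma> (s, t)
    = (norm (t - K s))\<^sup>2 + ((norm s)\<^sup>2 / \<sigma> - (norm (K s))\<^sup>2)"
  using adjoint_works[OF K, of s t]
  by (simp add: pdhg_matrix_def inner_diff_right inner_diff_left inner_add_right
      power2_norm_eq_inner inner_commute)

lemma step_size_gap_pos:
  fixes K :: "'a::euclidean_space \<Rightarrow> 'b::euclidean_space"
  assumes K: "linear K" and \<sigma>: "0 < \<sigma>" "\<sigma> < 1 / (onorm K)\<^sup>2" and s: "s \<noteq> 0"
  shows "(norm (K s))\<^sup>2 < (norm s)\<^sup>2 / \<sigma>"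
proof -
  have bl: "bounded_linear K" using K by (simp add: linear_linear)
  have "(norm (K s))\<^sup>2 \<le> (onorm K)\<^sup>2 * (norm s)\<^sup>2"
    using power_mono[OF onorm[OF bl, of s], of 2] by (simp add: power_mult_distrib)
  moreover have "(onorm K)\<^sup>2 < 1 / \<sigma>"
  proof -
    \<comment> \<open>If \<open>onorm K\<close> were 0, the bound \<open>1 / 0 = 0\<close> would contradict \<open>0 < \<sigma>\<close>.\<close>
    have "onorm K \<noteq> 0" using \<sigma> by auto
    then show ?thesis using \<sigma> by (simp add: field_simps)
  qed
  then have "(onorm K)\<^sup>2 * (norm s)\<^sup>2 < 1 / \<sigma> * (norm s)\<^sup>2"
    using s by (intro mult_strict_right_mono) auto
  ultimately show ?thesis by simp
qed

text \<open>
  For an actual displacement the residual is that of the updated primal point; the correction \<open>K s\<close>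
  undoes the extrapolation \<open>2 x' - x\<close> of the dual update. As \<open>t - K s\<close> depends continuously on
  \<open>(s, t)\<close>, the closure adds nothing when the set of residuals is closed.
\<close>

lemma displacement_residual:
  fixes K :: "'a::euclidean_space \<Rightarrow> 'b::euclidean_space"
  assumes K: "linear K" and C: "closed C" "C \<noteq> {}"
    and st: "(s, t) \<in> closure (range (\<lambda>z. z - pdhg_step K b C \<sigma> z))"
    and closed: "closed ((\<lambda>x. b - K x) ` C)"
  shows "t - K s \<in> (\<lambda>x. b - K x) ` C"
proof -
  define g where "g = (\<lambda>w. snd w - K (fst w))"
  have "g ((x, y) - pdhg_step K b C \<sigma> (x, y)) \<in> (\<lambda>x. b - K x) ` C" for x y
  proof -
    define x' where "x' = closest_point C (x - \<sigma> *\<^sub>R adjoint K y)"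
    have "x' \<in> C" using C by (simp add: x'_def closest_point_in_set)
    moreover have "g ((x, y) - pdhg_step K b C \<sigma> (x, y)) = b - K x'"
      by (simp add: g_def pdhg_step_def Let_def x'_def scaleR_2 linear_diff[OF K] linear_add[OF K])
    ultimately show ?thesis by simp
  qed
  then have "g ` range (\<lambda>z. z - pdhg_step K b C \<sigma> z) \<subseteq> (\<lambda>x. b - K x) ` C" by auto
  moreover have "continuous_on UNIV g"
    unfolding g_def using K
    by (intro continuous_intros linear_continuous_on_compose[where g = K]) (auto simp: linear_linear)
  ultimately have "g ` closure (range (\<lambda>z. z - pdhg_step K b C \<sigma> z)) \<subseteq> (\<lambda>x. b - K x) ` C"
    using closed by (meson image_closure_subset continuous_on_subset subset_UNIV)
  with st show ?thesis by (force simp: g_def)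
qed

text \<open>
  The vector \<open>(0, r)\<close> with \<open>r\<close> the minimal residual is a displacement, and comparing with it
  squeezes both terms of the completed square.
\<close>

lemma infimal_displacement_eq_minimal_residual:
  fixes K :: "'a::euclidean_space \<Rightarrow> 'b::euclidean_space"
  assumes K: "linear K" and C: "convex C" "closed C" "C \<noteq> {}" and KC: "closed (K ` C)"
    and \<sigma>: "0 < \<sigma>" "\<sigma> < 1 / (onorm K)\<^sup>2"
    and v: "is_infimal_displacement K b C \<sigma> (v_R, v_D)"
  shows "v_R = 0" and "v_D = closest_point ((\<lambda>x. b - K x) ` C) 0"
proof -
  let ?V = "range (\<lambda>z. z - pdhg_step K b C \<sigma> z)" and ?R = "(\<lambda>x. b - K x) ` C"
  have R: "closed ?R" "convex ?R" "?R \<noteq> {}"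
    using closed_residuals[OF KC] convex_residuals[OF K C(1)] C(3) by auto
  define r where "r = closest_point ?R 0"
  have r_min: "norm r \<le> norm w" if "w \<in> ?R" for w
    using closest_point_le[OF R(1) that, of 0] by (simp add: r_def)
  obtain x where x: "x \<in> C" "r = b - K x"
    using closest_point_in_set[OF R(1,3), of 0] by (auto simp: r_def)
  \<comment> \<open>With dual variable 0 the argument of the projection is \<open>x\<close> itself.\<close>
  have "(x, 0) - pdhg_step K b C \<sigma> (x, 0) = (0, r)"
    using x adjoint_linear[OF K]
    by (simp add: pdhg_step_def Let_def linear_0 closest_point_self linear_diff[OF K]
        linear_add[OF K] scaleR_2)
  then have "(0, r) \<in> closure ?V"
    by (metis closure_subset rangeI subsetD)
  with v have "pdhg_norm K \<sigma> (v_R, v_D) \<le> pdhg_norm K \<sigma> (0, r)"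
    and v_cl: "(v_R, v_D) \<in> closure ?V"
    by (auto simp: is_infimal_displacement_def is_arg_min_def not_less)
  then have le: "(norm (v_D - K v_R))\<^sup>2 + ((norm v_R)\<^sup>2 / \<sigma> - (norm (K v_R))\<^sup>2) \<le> (norm r)\<^sup>2"
    by (intro sqrt_le_D) (simp add: pdhg_norm_def pdhg_matrix_complete_square[OF K] linear_0[OF K])
  have res: "v_D - K v_R \<in> ?R"
    by (rule displacement_residual[OF K C(2,3) v_cl R(1)])
  have "(norm r)\<^sup>2 \<le> (norm (v_D - K v_R))\<^sup>2"
    using r_min[OF res] by (simp add: power_mono)
  with le have "(norm v_R)\<^sup>2 / \<sigma> \<le> (norm (K v_R))\<^sup>2" by linarith
  then show v_R: "v_R = 0"
    using step_size_gap_pos[OF K \<sigma>, of v_R] by force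
  with le res have "norm v_D \<le> norm r" and "v_D \<in> ?R"
    by (auto simp: linear_0[OF K] power2_le_iff_abs_le)
  then show "v_D = closest_point ?R 0"
    using r_min by (intro closest_point_unique R) (auto intro: order_trans)
qed

section \<open>The data of the ellipsoid separation problem\<close>

lemma linear_esp_map: "linear (esp_map A c B d)"
  by (rule linearI) (auto simp: esp_map_def sum.distrib scaleR_add_left matrix_vector_right_distrib
      matrix_vector_mult_scaleR scaleR_sum_right sum_distrib_left sum_subtractf algebra_simps)

lemma closed_second_order_cone: "closed second_order_cone"
proof -
  have "closed {z :: real \<times> (real ^ 'n). norm (snd z) \<le> fst z}"
    by (intro closed_Collect_le continuous_intros)
  then show ?thesis by (simp add: second_order_cone_def case_prod_unfold)
qed

lemma convex_second_order_cone: "convex second_order_cone"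
proof (rule convexI)
  fix z w :: "real \<times> (real ^ 'n)" and a b :: real
  assume "z \<in> second_order_cone" "w \<in> second_order_cone" and ab: "0 \<le> a" "0 \<le> b" "a + b = 1"
  then have "a * norm (snd z) \<le> a * fst z" "b * norm (snd w) \<le> b * fst w"
    by (auto simp: second_order_cone_def mult_left_mono)
  moreover have "norm (a *\<^sub>R snd z + b *\<^sub>R snd w) \<le> a * norm (snd z) + b * norm (snd w)"
    using ab norm_triangle_ineq[of "a *\<^sub>R snd z" "b *\<^sub>R snd w"] by simp
  ultimately show "a *\<^sub>R z + b *\<^sub>R w \<in> second_order_cone"
    by (auto simp: second_order_cone_def case_prod_unfold)
qed

lemma conic_second_order_cone: "conic second_order_cone"
  by (auto simp: conic_def second_order_cone_def mult_left_mono)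

lemma closed_esp_cone: "closed esp_cone"
proof -
  have "closed {x :: ('j::finite, 'l::finite, 'n::finite) esp_primal.
      (\<forall>i. fst x $ i \<in> second_order_cone) \<and> (\<forall>i. snd x $ i \<in> second_order_cone)}"
    using closed_second_order_cone
    by (intro closed_Collect_conj closed_Collect_all)
      (auto intro!: continuous_closed_vimage[unfolded vimage_def] continuous_intros)
  then show ?thesis by (simp add: esp_cone_def case_prod_unfold)
qed

lemma convex_esp_cone: "convex esp_cone"
  by (auto simp: convex_alt esp_cone_def intro: convexD_alt[OF convex_second_order_cone])

lemma conic_esp_cone: "conic esp_cone"
  by (auto simp: conic_def esp_cone_def intro: conicD[OF conic_second_order_cone])

section \<open>Minimal residual of the ellipsoid separation problem\<close>

theorem theorem2p1:
  fixes A :: "'j::finite \<Rightarrow> real ^ 'n ^ 'n" and c :: "'j \<Rightarrow> real ^ 'n"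
    and B :: "'l::finite \<Rightarrow> real ^ 'n ^ 'n" and d :: "'l \<Rightarrow> real ^ 'n"
    and \<sigma> :: real
    and v_R :: "('j, 'l, 'n::finite) esp_primal" and v_D :: "'n esp_dual"
  assumes "esp_instance A c B d"
    and "0 < \<sigma>" and "\<sigma> < 1 / (onorm (esp_map A c B d))\<^sup>2"
    and "{x. esp_map A c B d x = 0} \<inter> esp_cone = {0}"
    and "is_infimal_displacement (esp_map A c B d) esp_rhs esp_cone \<sigma> (v_R, v_D)"
  shows "(\<exists>x\<in>esp_cone. esp_rhs - esp_map A c B d x = v_D) \<and>
    {r. is_arg_min norm (\<lambda>r. r \<in> (\<lambda>x. esp_rhs - esp_map A c B d x) ` esp_cone) r} = {v_D} \<and>
    {x \<in> esp_cone. esp_rhs - esp_map A c B d x = v_D} =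
      {x. is_arg_min (least_squares (esp_map A c B d) esp_rhs) (\<lambda>x. x \<in> esp_cone) x}"
proof -
  let ?K = "esp_map A c B d" and ?b = "esp_rhs :: 'n esp_dual"
  let ?C = "esp_cone :: ('j, 'l, 'n) esp_primal set"
  let ?R = "(\<lambda>x. ?b - ?K x) ` ?C"
  have ne: "?C \<noteq> {}" using assms(4) by auto
  have KC: "closed (?K ` ?C)"
    using assms(4) by (intro closed_linear_image_of_cone linear_esp_map closed_esp_cone
        conic_esp_cone) auto
  have R: "closed ?R" "convex ?R" "?R \<noteq> {}"
    using ne by (simp_all add: closed_residuals[OF KC]
        convex_residuals[OF linear_esp_map convex_esp_cone])
  have v_D: "v_D = closest_point ?R 0"
    using infimal_displacement_eq_minimal_residual(2)[OF linear_esp_map convex_esp_cone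
        closed_esp_cone ne KC assms(2,3,5)] .
  then have v_in: "v_D \<in> ?R"
    using closest_point_in_set[OF R(1,3)] by simp
  have v_min: "norm v_D \<le> norm r" if "r \<in> ?R" for r
    using closest_point_le[OF R(1) that, of 0] by (simp add: v_D)
  have v_unique: "r = v_D" if "r \<in> ?R" "norm r \<le> norm v_D" for r
    unfolding v_D by (rule closest_point_unique[OF R(2,1) that(1)])
      (use order_trans[OF that(2) v_min] in simp)
  have arg_min: "is_arg_min norm (\<lambda>r. r \<in> ?R) r \<longleftrightarrow> r = v_D" for r
    using v_in v_min v_unique unfolding is_arg_min_def not_ex de_Morgan_conj not_less
    by (metis linorder_le_less_linear)
  have less_iff: "least_squares ?K ?b x < least_squares ?K ?b y
      \<longleftrightarrow> norm (?b - ?K x) < norm (?b - ?K y)" for x y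
    by (simp add: least_squares_def norm_minus_commute flip: not_le)
  have "is_arg_min (least_squares ?K ?b) (\<lambda>x. x \<in> ?C) x
      \<longleftrightarrow> x \<in> ?C \<and> is_arg_min norm (\<lambda>r. r \<in> ?R) (?b - ?K x)" for x
    by (auto simp: is_arg_min_def less_iff)
  then show ?thesis
    using v_in by (auto simp: arg_min)
qed

end
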